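(* Let $\mathbf{f}\in C_c^\infty(S^1;\mathbb{D})$ be a vector field. Then $\mathbf{f}$ can be recovered from the knowledge of its longitudinal Gaussian beam Radon transform $\mathcal{L}\mathbf{f}$ and its transverse Gaussian beam Radon transform $\mathcal{T}\mathbf{f}$. That is, $\mathbf{f}$ is uniquely determined by this data: if $\mathbf{f},\mathbf{h}\in C_c^\infty(S^1;\mathbb{D})$ satisfy $\mathcal{L}\mathbf{f}(s,\theta)=\mathcal{L}\mathbf{h}(s,\theta)$ and $\mathcal{T}\mathbf{f}(s,\theta)=\mathcal{T}\mathbf{h}(s,\theta)$ for all $s\in\mathbb{R}$ and $\theta\in[0,2\pi)$, then $\mathbf{f}=\mathbf{h}$.
   Context: Let $\mathbb{D}\subseteq\mathbb{R}^2$ be the (open) unit disk. $C_c^\infty(S^1;\mathbb{D})$ denotes the space of vector fields $\mathbf{f}=(f_1,f_2)$ whose components are smooth compactly supported functions on $\mathbb{D}$, extended by zero to $\mathbb{R}^2$. Fix constants $w_0>0$ and $\lambda>0$, and put $z_R=\pi w_0^2/\lambda$ and $w(u)=w_0\sqrt{1+(u/z_R)^2}$ for $u\in\mathbb{R}$. The Gaussian beam kernel is $$K(x_1,x_2)=\frac{w_0}{w(x_2)}\exp\left(-\frac{x_1^2}{w^2(x_2)}\right).$$ For an angle $\theta\in[0,2\pi)$ write $\boldsymbol{\theta}=(\cos\theta,\sin\theta)$ and $\boldsymbol{\theta}^\perp=(-\sin\theta,\cos\theta)$. For $s\in\mathbb{R}$ and $\theta\in[0,2\pi)$ define $$\mathcal{L}\mathbf{f}(s,\theta)=\int_{\mathbb{R}^2}K(s-\boldsymbol{\theta}\cdot\mathbf{x},\,\boldsymbol{\theta}^\perp\cdot\mathbf{x})\,\boldsymbol{\theta}^\perp\cdot\mathbf{f}(\mathbf{x})\,d\mathbf{x},$$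 $$\mathcal{T}\mathbf{f}(s,\theta)=\int_{\mathbb{R}^2}K(s-\boldsymbol{\theta}\cdot\mathbf{x},\,\boldsymbol{\theta}^\perp\cdot\mathbf{x})\,\boldsymbol{\theta}\cdot\mathbf{f}(\mathbf{x})\,d\mathbf{x}.$$ *)

theory Defs
  imports "HOL-Analysis.Analysis"
begin

text \<open>\<open>C_on n S g\<close>: the scalar function \<open>g\<close> is of class \<open>C\<^sup>n\<close> on the open set \<open>S\<close>.  Outside \<open>S\<close>
  the Frechet derivative may be unspecified, but for open \<open>S\<close> the predicate depends only on the
  values of \<open>g\<close> in \<open>S\<close>.\<close>

primrec C_on :: "nat \<Rightarrow> (real^2) set \<Rightarrow> (real^2 \<Rightarrow> real) \<Rightarrow> bool" where
  "C_on 0 S g \<longleftrightarrow> continuous_on S g"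
| "C_on (Suc n) S g \<longleftrightarrow> (\<forall>x\<in>S. g differentiable (at x)) \<and>
     (\<forall>i. C_on n S (\<lambda>x. frechet_derivative g (at x) (axis i 1)))"

definition smooth_on :: "(real^2) set \<Rightarrow> (real^2 \<Rightarrow> real) \<Rightarrow> bool" where
  "smooth_on S g \<longleftrightarrow> (\<forall>n. C_on n S g)"

text \<open>The support is taken in the whole plane, so a function in \<open>Cc_inf S\<close> vanishes outside \<open>S\<close>;
  this is the extension by zero.\<close>

definition Cc_inf :: "(real^2) set \<Rightarrow> (real^2 \<Rightarrow> real) set" where
  "Cc_inf S = {g. smooth_on S g \<and> compact (closure {x. g x \<noteq> 0}) \<and> closure {x. g x \<noteq> 0} \<subseteq> S}"

definition unit_disk :: "(real^2) set" where
  "unit_disk = ball 0 1"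

definition Cc_inf_fields :: "(real^2) set \<Rightarrow> (real^2 \<Rightarrow> real^2) set" where
  "Cc_inf_fields S = {f. \<forall>i. (\<lambda>x. f x $ i) \<in> Cc_inf S}"

text \<open>In the following, \<open>w0\<close> is the waist radius and \<open>l\<close> the wavelength \<open>\<lambda>\<close> of the beam.\<close>

definition rayleigh_range :: "real \<Rightarrow> real \<Rightarrow> real" where
  "rayleigh_range w0 l = pi * w0\<^sup>2 / l"

definition beam_width :: "real \<Rightarrow> real \<Rightarrow> real \<Rightarrow> real" where
  "beam_width w0 l u = w0 * sqrt (1 + (u / rayleigh_range w0 l)\<^sup>2)"

definition beam_kernel :: "real \<Rightarrow> real \<Rightarrow> real \<Rightarrow> real \<Rightarrow> real" where
  "beam_kernel w0 l x1 x2 = w0 / beam_width w0 l x2 * exp (- (x1\<^sup>2 / (beam_width w0 l x2)\<^sup>2))"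

definition dir :: "real \<Rightarrow> real^2" where
  "dir \<theta> = vector [cos \<theta>, sin \<theta>]"

definition dir_perp :: "real \<Rightarrow> real^2" where
  "dir_perp \<theta> = vector [- sin \<theta>, cos \<theta>]"

definition longitudinal_transform ::
    "real \<Rightarrow> real \<Rightarrow> (real^2 \<Rightarrow> real^2) \<Rightarrow> real \<Rightarrow> real \<Rightarrow> real" where
  "longitudinal_transform w0 l f s \<theta> =
     (LINT x|lborel. beam_kernel w0 l (s - dir \<theta> \<bullet> x) (dir_perp \<theta> \<bullet> x) * (dir_perp \<theta> \<bullet> f x))"

definition transverse_transform ::
    "real \<Rightarrow> real \<Rightarrow> (real^2 \<Rightarrow> real^2) \<Rightarrow> real \<Rightarrow> real \<Rightarrow> real" where
  "transverse_transform w0 l f s \<theta> =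
     (LINT x|lborel. beam_kernel w0 l (s - dir \<theta> \<bullet> x) (dir_perp \<theta> \<bullet> x) * (dir \<theta> \<bullet> f x))"

end

theory Submission
  imports Defs "HOL-Probability.Distributions"
begin

text \<open>
  For each \<open>\<theta>\<close> the vectors \<open>dir \<theta>\<close> and \<open>dir_perp \<theta>\<close> are orthonormal, so the two transforms together
  carry the scalar transform of each Cartesian component of the field, with the same kernel. It
  remains to see that a scalar function \<open>g\<close>, continuous and vanishing off the unit disk, is zero if
  its scalar Gaussian beam transform is zero.

  As a function of \<open>s\<close>, the kernel is a multiple of a normal density with mean \<open>u = \<theta> \<bullet> x\<close> and variance
  \<open>w(v)\<^sup>2 / 2 = w0\<^sup>2 / 2 + (\<beta> v)\<^sup>2\<close>, where \<open>v = \<theta>\<^sup>\<bottom> \<bullet> x\<close> and \<open>\<beta> = w0 / (sqrt 2 z_R)\<close>. Multiplying the data by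
  \<open>s\<^sup>n\<close> and integrating over \<open>s\<close> therefore turns them into integrals of \<open>g\<close> against the moments of these normal
  laws (\<open>beam_data_moments\<close>). The constant part \<open>w0\<^sup>2 / 2\<close> of the variance acts on these moments as a
  triangular substitution and can be removed (\<open>heat_poly_moments_shift\<close>). What is left are integrals of
  \<open>g\<close> against \<open>E (u + \<beta> v X)\<^sup>n\<close>, \<open>X\<close> standard normal, which is homogeneous of degree \<open>n\<close> in \<open>x\<close>.

  Write \<open>z = x\<^sub>1 + \<i> x\<^sub>2\<close>. Then \<open>u + \<beta> v X\<close> is the real part of \<open>exp (- \<i> \<theta>) z (1 - \<i> \<beta> X)\<close>, so the integral is a
  trigonometric polynomial in \<open>\<theta>\<close> whose coefficients are multiples of \<open>D(a,b) M(a,b)\<close> with \<open>a + b = n\<close>, where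
  \<open>D(a,b) = E (1 - \<i> \<beta> X)\<^sup>a (1 + \<i> \<beta> X)\<^sup>b\<close> and \<open>M(a,b)\<close> is the moment of \<open>g\<close> against \<open>z\<^sup>a cnj z\<^sup>b\<close>. Hence all these
  products vanish (\<open>moments_times_beam_coeff\<close>).

  The factor \<open>D(a,b)\<close> can be zero: \<open>D(2,0) = 1 - \<beta>\<^sup>2\<close>, for instance. But along a diagonal \<open>a - b = k \<ge> 0\<close> it is
  nonzero from some point on, because for large \<open>b\<close> the weight \<open>(1 + \<beta>\<^sup>2 X\<^sup>2)\<^sup>b\<close> moves all the mass to where the
  polynomial \<open>Re (1 - \<i> \<beta> X)\<^sup>k\<close> has a fixed sign (\<open>eventually_beam_coeff_nonzero\<close>). So on each diagonal only
  finitely many moments could be different from zero, and as \<open>g\<close> lives in the unit disk these are determined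
  by the higher ones (\<open>radial_moments_descend\<close>). The diagonals \<open>k < 0\<close> follow by conjugation. All moments vanish, and \<open>g = 0\<close> by the theorem of Stone and
  Weierstrass (\<open>disk_supported_determined_by_moments\<close>).
\<close>

section \<open>Moments of normal laws as heat polynomials\<close>

text \<open>The polynomial \<open>E (u + sqrt q X)\<^sup>n\<close> for a standard normal \<open>X\<close>. Only even powers of \<open>X\<close> contribute, so
  it is polynomial in the variance \<open>q\<close>; in \<open>(u, q)\<close> it solves the heat equation \<open>\<partial>\<^sub>q = \<partial>\<^sub>u\<^sup>2 / 2\<close>.\<close>
definition heat_poly :: "nat \<Rightarrow> real \<Rightarrow> real \<Rightarrow> real" where
  "heat_poly n u q = (\<Sum>i\<le>n div 2. fact n / (fact (n - 2*i) * fact i * 2^i) * u^(n - 2*i) * q^i)"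

text \<open>The scale \<open>\<sigma>\<close> may be negative or zero: it will be \<open>\<beta> v\<close>, where \<open>v\<close> is the signed distance of a point from the
  waist of the beam.\<close>
lemma has_bochner_integral_std_normal_affine_power:
  "has_bochner_integral lborel (\<lambda>x. std_normal_density x * (u + \<sigma> * x)^n) (heat_poly n u (\<sigma>\<^sup>2))"
proof -
  define m :: "nat \<Rightarrow> real" where
    "m j = (if even j then fact j / (2^(j div 2) * fact (j div 2)) else 0)" for j
  have m: "has_bochner_integral lborel (\<lambda>x. std_normal_density x * x^j) (m j)" for j
  proof (cases "even j")
    case True
    then obtain k where "j = 2*k" by (elim evenE)
    then show ?thesis using normal_moment_even[of 1 0 k] by (simp add: m_def)
  next
    case False
    then obtain k where "j = 2*k+1" by (elim oddE)
    then show ?thesis using normal_moment_odd[of 1 0 k] by (simp add: m_def)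
  qed
  let ?c = "\<lambda>j. real (n choose j) * u^(n-j) * \<sigma>^j"
  have "has_bochner_integral lborel (\<lambda>x. \<Sum>j\<le>n. ?c j * (std_normal_density x * x^j)) (\<Sum>j\<le>n. ?c j * m j)"
    by (intro has_bochner_integral_sum has_bochner_integral_mult_right m)
  moreover have "(\<Sum>j\<le>n. ?c j * (std_normal_density x * x^j)) = std_normal_density x * (u + \<sigma> * x)^n" for x
    by (subst add.commute, subst binomial_ring)
       (simp add: sum_distrib_left power_mult_distrib mult_ac)
  moreover have "(\<Sum>j\<le>n. ?c j * m j) = heat_poly n u (\<sigma>\<^sup>2)"
  proof -
    have "(\<Sum>j\<le>n. ?c j * m j) = (\<Sum>j\<in>(\<lambda>i. 2*i) ` {..n div 2}. ?c j * m j)"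
      by (rule sum.mono_neutral_right) (auto simp: m_def elim!: evenE)
    also have "\<dots> = (\<Sum>i\<le>n div 2. ?c (2*i) * m (2*i))"
      by (subst sum.reindex) (auto simp: inj_on_def)
    also have "\<dots> = heat_poly n u (\<sigma>\<^sup>2)"
      unfolding heat_poly_def
    proof (rule sum.cong[OF refl])
      fix i assume "i \<in> {..n div 2}"
      then have "2*i \<le> n" by auto
      then show "?c (2*i) * m (2*i) =
          fact n / (fact (n - 2*i) * fact i * 2^i) * u^(n - 2*i) * (\<sigma>\<^sup>2)^i"
        by (simp add: binomial_fact m_def power_mult)
    qed
    finally show ?thesis .
  qed
  ultimately show ?thesis by simp
qed

text \<open>The sum of independent normal variables of variances \<open>q\<close> and \<open>r\<close> is normal of variance \<open>q + r\<close>; this is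
  the corresponding identity between moments, in a form that isolates \<open>r\<close>. It is triangular in \<open>n\<close>.\<close>
lemma heat_poly_add:
  "heat_poly n u (q + r) =
     (\<Sum>i\<le>n div 2. fact n / (fact (n - 2*i) * fact i * 2^i) * r^i * heat_poly (n - 2*i) u q)"
proof -
  define N where "N = n div 2"
  let ?t = "\<lambda>j i. fact n / (fact (n - 2*(j+i)) * fact j * fact i * 2^(j+i)) * u^(n - 2*(j+i)) * r^j * q^i"
  have "heat_poly n u (q + r) = (\<Sum>k\<le>N. \<Sum>j\<le>k. ?t j (k-j))"
    unfolding heat_poly_def N_def[symmetric] add.commute[of q r] binomial_ring sum_distrib_left
    by (intro sum.cong refl) (simp add: binomial_fact power_add[symmetric] field_simps)
  also have "\<dots> = (\<Sum>(j,i)\<in>{(j,i). j+i \<le> N}. ?t j i)"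
    by (rule sum.triangle_reindex_eq[symmetric])
  also have "{(j,i). j+i \<le> N} = (SIGMA j:{..N}. {..N-j})"
    by auto
  also have "(\<Sum>(j,i)\<in>\<dots>. ?t j i) = (\<Sum>j\<le>N. \<Sum>i\<le>N-j. ?t j i)"
    by (simp add: sum.Sigma)
  also have "\<dots> = (\<Sum>j\<le>N. fact n / (fact (n - 2*j) * fact j * 2^j) * r^j * heat_poly (n - 2*j) u q)"
  proof (rule sum.cong[OF refl])
    fix j assume "j \<in> {..N}"
    then have "(n - 2*j) div 2 = N - j" by (auto simp: N_def)
    then show "(\<Sum>i\<le>N-j. ?t j i) = fact n / (fact (n - 2*j) * fact j * 2^j) * r^j * heat_poly (n - 2*j) u q"
      unfolding heat_poly_def
      by (auto simp: sum_distrib_left power_add field_simps intro!: sum.cong)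
  qed
  finally show ?thesis by (simp add: N_def)
qed

lemma continuous_on_heat_poly [continuous_intros]:
  "continuous_on A U \<Longrightarrow> continuous_on A Q \<Longrightarrow> continuous_on A (\<lambda>x. heat_poly n (U x) (Q x))"
  unfolding heat_poly_def by (intro continuous_intros)

lemma has_bochner_integral_normal_density_power:
  assumes "\<sigma> > 0"
  shows "has_bochner_integral lborel (\<lambda>s. normal_density u \<sigma> s * s^n) (heat_poly n u (\<sigma>\<^sup>2))"
proof -
  have "normal_density u \<sigma> (u + \<sigma> * x) = 1 / \<sigma> * std_normal_density x" for x
    using assms by (simp add: normal_density_def real_sqrt_mult field_simps power_mult_distrib)
  with has_bochner_integral_mult_right[OF has_bochner_integral_std_normal_affine_power[of u \<sigma> n], of "1 / \<sigma>"]
  show ?thesis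
    using assms
    by (subst lborel_has_bochner_integral_real_affine_iff[where c=\<sigma> and t=u]) (simp_all add: divide_inverse mult_ac)
qed

section \<open>Functions supported in the unit disk\<close>

definition to_complex :: "real^2 \<Rightarrow> complex" where
  "to_complex x = Complex (x $ 1) (x $ 2)"

lemma continuous_on_to_complex [continuous_intros]: "continuous_on A to_complex"
proof -
  have "to_complex = (\<lambda>x. of_real (x $ 1) + \<i> * of_real (x $ 2))"
    by (auto simp: to_complex_def complex_eq_iff)
  then show ?thesis by (rule ssubst) (intro continuous_intros)
qed

lemma norm_to_complex [simp]: "norm (to_complex x) = norm x"
  by (simp add: to_complex_def norm_vec_def L2_set_def UNIV_2 cmod_def)

text \<open>Multiplying by a continuous function preserves this property, so the integrands over the plane below are
  integrable by \<open>integrable_disk_supported\<close>.\<close>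
definition disk_supported :: "(real^2 \<Rightarrow> 'b::real_normed_vector) \<Rightarrow> bool" where
  "disk_supported F \<longleftrightarrow> continuous_on UNIV F \<and> (\<forall>x. norm x \<ge> 1 \<longrightarrow> F x = 0)"

lemma disk_supportedD:
  assumes "disk_supported F"
  shows "continuous_on A F" "norm x \<ge> 1 \<Longrightarrow> F x = 0"
  using assms by (auto simp: disk_supported_def intro: continuous_on_subset)

lemma integrable_disk_supported:
  fixes F :: "real^2 \<Rightarrow> 'b::{banach,second_countable_topology}"
  assumes "disk_supported F"
  shows "integrable lborel F"
proof -
  have "integrable lborel (\<lambda>x. indicator (cball 0 1) x *\<^sub>R F x)"
    using assms by (intro borel_integrable_compact disk_supportedD) auto
  also have "(\<lambda>x. indicator (cball 0 1) x *\<^sub>R F x) = F"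
    using disk_supportedD(2)[OF assms] by (force simp: indicator_def)
  finally show ?thesis .
qed

lemma disk_supported_mult:
  fixes F G :: "real^2 \<Rightarrow> 'b::real_normed_algebra"
  assumes "disk_supported F" "continuous_on UNIV G"
  shows "disk_supported (\<lambda>x. F x * G x)"
  using assms by (auto simp: disk_supported_def intro!: continuous_intros)

lemma disk_supported_of_real:
  "disk_supported g \<Longrightarrow> disk_supported (\<lambda>x. complex_of_real (g x))"
  by (auto simp: disk_supported_def intro!: continuous_intros)

lemma disk_supported_mult_to_complex:
  "disk_supported h \<Longrightarrow> disk_supported (\<lambda>x. h x * (to_complex x^a * cnj (to_complex x)^b))"
  by (intro disk_supported_mult continuous_intros)

section \<open>Complex moments determine a function on the disk\<close>

text \<open>A nonempty open set is not negligible.\<close>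
lemma continuous_AE_zero:
  fixes g :: "real^2 \<Rightarrow> real"
  assumes "continuous_on UNIV g" "AE x in lborel. g x = 0"
  shows "g x = 0"
proof -
  let ?U = "{x. g x \<noteq> 0}"
  have op: "open ?U"
    using assms(1) by (intro open_Collect_neq continuous_intros)
  then have "?U \<in> null_sets lborel"
    using AE_iff_null_sets[of ?U lborel] assms(2) by auto
  then have "negligible ?U"
    by (simp add: negligible_iff_null_sets null_sets_completionI)
  then have "?U = {}"
    using open_not_negligible[OF op] by blast
  then show ?thesis by auto
qed

text \<open>The functions whose complex moments all vanish are stable under multiplication by the coordinates,
  hence by polynomials. So \<open>g\<close> is orthogonal to all polynomials, and approximating \<open>g\<close> by polynomials on
  the closed disk gives \<open>\<integral> g\<^sup>2 = 0\<close>.\<close>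
lemma disk_supported_determined_by_moments:
  fixes g :: "real^2 \<Rightarrow> real"
  assumes g: "disk_supported g"
    and moments: "\<And>a b. (LINT x|lborel. complex_of_real (g x) * (to_complex x^a * cnj (to_complex x)^b)) = 0"
  shows "g x = 0"
proof -
  define N where "N q \<longleftrightarrow> disk_supported q \<and>
    (\<forall>a b. (LINT x|lborel. complex_of_real (q x) * (to_complex x^a * cnj (to_complex x)^b)) = 0)" for q
  have int: "integrable lborel (\<lambda>x. complex_of_real (q x) * (to_complex x^a * cnj (to_complex x)^b))"
    if "N q" for q a b
    using that
    by (intro integrable_disk_supported disk_supported_mult_to_complex disk_supported_of_real) (simp add: N_def)
  have N_add: "N (\<lambda>x. q x + r x)" if "N q" "N r" for q r
    using that int[OF that(1)] int[OF that(2)]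
    by (auto simp: N_def disk_supported_def distrib_right intro!: continuous_intros)
  have N_scale: "N (\<lambda>x. q x * c)" if "N q" for q c
  proof -
    have "(LINT x|lborel. complex_of_real (q x * c) * (to_complex x^a * cnj (to_complex x)^b)) =
        of_real c * (LINT x|lborel. complex_of_real (q x) * (to_complex x^a * cnj (to_complex x)^b))" for a b
      by (subst integral_mult_right_zero[symmetric]) (simp add: mult_ac)
    then show ?thesis using that by (auto simp: N_def disk_supported_def intro!: continuous_intros)
  qed
  have N_coord: "N (\<lambda>x. q x * x $ 1)" "N (\<lambda>x. q x * x $ 2)" if "N q" for q
  proof -
    have supp: "disk_supported (\<lambda>x. q x * x $ i)" for i
      using that by (intro disk_supported_mult continuous_intros) (simp add: N_def)
    let ?m = "\<lambda>a b x. complex_of_real (q x) * (to_complex x^a * cnj (to_complex x)^b)"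
    have 1: "complex_of_real (q x * x $ 1) * (to_complex x^a * cnj (to_complex x)^b)
        = (?m (Suc a) b x + ?m a (Suc b) x) / 2" for x a b
    proof -
      have "complex_of_real (x $ 1) = (to_complex x + cnj (to_complex x)) / 2"
        by (simp add: to_complex_def complex_eq_iff)
      then show ?thesis by (simp only: of_real_mult) (simp add: algebra_simps)
    qed
    have 2: "complex_of_real (q x * x $ 2) * (to_complex x^a * cnj (to_complex x)^b)
        = (?m (Suc a) b x - ?m a (Suc b) x) / (2 * \<i>)" for x a b
    proof -
      have "complex_of_real (x $ 2) = (to_complex x - cnj (to_complex x)) / (2 * \<i>)"
        by (simp add: to_complex_def complex_eq_iff)
      then show ?thesis by (simp only: of_real_mult) (simp add: diff_divide_distrib algebra_simps)
    qed
    have m: "(LINT x|lborel. ?m a b x) = 0" for a b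
      using that by (simp add: N_def)
    show "N (\<lambda>x. q x * x $ 1)"
      unfolding N_def 1 using supp[of 1] int[OF that] m by (simp del: power_Suc)
    show "N (\<lambda>x. q x * x $ 2)"
      unfolding N_def 2 using supp[of 2] int[OF that] m by (simp del: power_Suc)
  qed
  have N_poly: "\<forall>q. N q \<longrightarrow> N (\<lambda>x. q x * p x)" if "real_polynomial_function p" for p :: "real^2 \<Rightarrow> real"
    using that
  proof induction
    case (linear f)
    have f: "f x = x $ 1 * f (axis 1 1) + x $ 2 * f (axis 2 1)" for x
    proof -
      have "x = x $ 1 *\<^sub>R axis 1 1 + x $ 2 *\<^sub>R axis 2 1"
        by (simp add: vec_eq_iff forall_2 axis_def)
      then have "f x = f (x $ 1 *\<^sub>R axis 1 1 + x $ 2 *\<^sub>R axis 2 1)" by simp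
      then show ?thesis
        using bounded_linear.linear[OF linear] by (simp add: linear_add linear_scale)
    qed
    show ?case
    proof safe
      fix q assume "N q"
      then have "N (\<lambda>x. q x * x $ 1 * f (axis 1 1) + q x * x $ 2 * f (axis 2 1))"
        by (intro N_add N_scale N_coord)
      then show "N (\<lambda>x. q x * f x)" by (subst f) (simp add: algebra_simps)
    qed
  next
    case (const c)
    then show ?case using N_scale by simp
  next
    case (add f h)
    then show ?case using N_add by (auto simp: distrib_left)
  next
    case (mult f h)
    then show ?case by (auto simp: mult.assoc[symmetric])
  qed
  have "N g" using g moments by (simp add: N_def)
  have orth: "(LINT x|lborel. g x * p x) = 0" if "real_polynomial_function p" for p
  proof -
    have "(LINT x|lborel. complex_of_real (g x * p x)) = 0"
      using N_poly[OF that] \<open>N g\<close> unfolding N_def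
      by (metis (no_types, lifting) Bochner_Integration.integral_cong mult.right_neutral power_0)
    then show ?thesis by (simp only: integral_complex_of_real of_real_eq_0_iff)
  qed
  have gg: "integrable lborel (\<lambda>x. g x * g x)"
    using g by (intro integrable_disk_supported disk_supported_mult disk_supportedD)
  have "(LINT x|lborel. g x * g x) \<le> 0"
  proof (rule field_le_epsilon)
    fix e :: real assume "e > 0"
    define C where "C = (LINT x|lborel. \<bar>g x\<bar>)"
    have "C \<ge> 0" by (simp add: C_def)
    obtain p where p: "real_polynomial_function p" and close: "\<And>x. x \<in> cball 0 1 \<Longrightarrow> \<bar>g x - p x\<bar> < e / (C + 1)"
      using Stone_Weierstrass_real_polynomial_function[of "cball 0 1" g "e / (C+1)"]
        disk_supportedD(1)[OF g] \<open>e > 0\<close> \<open>C \<ge> 0\<close> by auto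
    have gp: "integrable lborel (\<lambda>x. g x * p x)"
      using g p by (intro integrable_disk_supported disk_supported_mult
          continuous_on_polymonial_function) (auto simp: real_polynomial_function_eq)
    have "(LINT x|lborel. g x * g x) = (LINT x|lborel. g x * g x - g x * p x)"
      using orth[OF p] gg gp by simp
    also have "\<dots> \<le> (LINT x|lborel. \<bar>g x\<bar> * (e / (C + 1)))"
    proof (rule integral_mono)
      show "integrable lborel (\<lambda>x. g x * g x - g x * p x)"
        using gg gp by simp
      show "integrable lborel (\<lambda>x. \<bar>g x\<bar> * (e / (C + 1)))"
        using integrable_disk_supported[OF g] by auto
      fix x :: "real^2"
      show "g x * g x - g x * p x \<le> \<bar>g x\<bar> * (e / (C + 1))"
      proof (cases "norm x \<le> 1")
        case True
        have "g x * (g x - p x) \<le> \<bar>g x\<bar> * \<bar>g x - p x\<bar>"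
          by (metis abs_ge_self abs_mult)
        also have "\<dots> \<le> \<bar>g x\<bar> * (e / (C + 1))"
          using close[of x] True by (intro mult_left_mono) auto
        finally show ?thesis by (simp add: right_diff_distrib)
      qed (use disk_supportedD(2)[OF g, of x] in auto)
    qed
    also have "\<dots> = C * (e / (C + 1))" by (simp add: C_def)
    also have "\<dots> \<le> e" using \<open>e > 0\<close> \<open>C \<ge> 0\<close> by (simp add: field_simps)
    finally show "(LINT x|lborel. g x * g x) \<le> 0 + e" by simp
  qed
  moreover have "(LINT x|lborel. g x * g x) \<ge> 0" by simp
  ultimately have "(LINT x|lborel. g x * g x) = 0" by simp
  then have "AE x in lborel. g x * g x = 0"
    using integral_nonneg_eq_0_iff_AE[OF gg] by simp
  then show ?thesis
    using continuous_AE_zero[of g x] disk_supportedD(1)[OF g] by simp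
qed

text \<open>With \<open>\<rho> = (norm x)\<^sup>2\<close>, the polynomial \<open>1 - (1 - \<rho>)\<^sup>n\<close> is divisible by \<open>\<rho>\<close>. If all moments of order above \<open>M\<close>
  vanish, then \<open>\<integral> h \<rho>\<^sup>M\<close> therefore equals \<open>\<integral> h \<rho>\<^sup>M (1 - \<rho>)\<^sup>n\<close> for every \<open>n\<close>, and the latter tends to \<open>0\<close> since
  \<open>0 \<le> 1 - \<rho> < 1\<close> on the punctured unit disk. So vanishing passes from high orders down to order \<open>0\<close>.\<close>
lemma radial_moments_descend:
  fixes h :: "real^2 \<Rightarrow> complex"
  assumes h: "disk_supported h"
    and high: "\<forall>\<^sub>F m in sequentially. (LINT x|lborel. h x * of_real ((norm x)\<^sup>2)^m) = 0"
  shows "(LINT x|lborel. h x * of_real ((norm x)\<^sup>2)^m) = 0"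
proof -
  let ?r = "\<lambda>x::real^2. complex_of_real ((norm x)\<^sup>2)"
  have int: "integrable lborel (\<lambda>x. h x * ?r x^m)" for m
    by (intro integrable_disk_supported disk_supported_mult h continuous_intros)
  have step: "(LINT x|lborel. h x * ?r x^M) = 0" if M: "\<And>j. j > M \<Longrightarrow> (LINT x|lborel. h x * ?r x^j) = 0" for M
  proof -
    have "(LINT x|lborel. h x * ?r x^M * (1 - ?r x)^n) = (LINT x|lborel. h x * ?r x^M)" for n
    proof -
      have "h x * ?r x^M * (1 - ?r x)^n =
          (\<Sum>i\<le>n. of_nat (n choose i) * (-1)^i * (h x * ?r x^(M+i)))" for x
        using binomial_ring[of "- ?r x" 1 n]
        by (simp add: sum_distrib_left power_add power_minus[of "(complex_of_real (norm x))\<^sup>2"] mult_ac)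
      then have "(LINT x|lborel. h x * ?r x^M * (1 - ?r x)^n) =
          (\<Sum>i\<le>n. of_nat (n choose i) * (-1)^i * (LINT x|lborel. h x * ?r x^(M+i)))"
        using int by (simp only: Bochner_Integration.integral_sum integrable_mult_right integral_mult_right_zero)
      also have "\<dots> = (\<Sum>i\<in>{0}. of_nat (n choose i) * (-1)^i * (LINT x|lborel. h x * ?r x^(M+i)))"
      proof (rule sum.mono_neutral_right)
        show "\<forall>i\<in>{..n} - {0}. of_nat (n choose i) * (-1)^i * (LINT x|lborel. h x * ?r x^(M+i)) = 0"
        proof
          fix i assume "i \<in> {..n} - {0}"
          then have "(LINT x|lborel. h x * ?r x^(M+i)) = 0" by (intro M) auto
          then show "of_nat (n choose i) * (-1)^i * (LINT x|lborel. h x * ?r x^(M+i)) = 0"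
            by (simp only: mult_zero_right)
        qed
      qed auto
      finally show ?thesis by simp
    qed
    moreover have "(\<lambda>n. LINT x|lborel. h x * ?r x^M * (1 - ?r x)^n) \<longlonglongrightarrow> (LINT x|(lborel :: (real^2) measure). 0)"
    proof (rule integral_dominated_convergence)
      show "integrable lborel (\<lambda>x. norm (h x * ?r x^M))"
        using int[of M] by (rule integrable_norm)
      show "(\<lambda>x. h x * ?r x^M * (1 - ?r x)^n) \<in> borel_measurable lborel" for n
        by (intro borel_measurable_integrable integrable_disk_supported disk_supported_mult h continuous_intros)
      have norm: "norm (1 - ?r x) = \<bar>1 - (norm x)\<^sup>2\<bar>" for x
        by (metis norm_of_real of_real_1 of_real_diff)
      have small: "norm (1 - ?r x) \<le> 1" if "norm x < 1" for x
        using that power_mono[of "norm x" 1 2] by (simp only: norm) auto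
      show "AE x in lborel. norm (h x * ?r x^M * (1 - ?r x)^n) \<le> norm (h x * ?r x^M)" for n
      proof (rule AE_I2)
        fix x :: "real^2"
        show "norm (h x * ?r x^M * (1 - ?r x)^n) \<le> norm (h x * ?r x^M)"
        proof (cases "norm x < 1")
          case True
          then have "norm (1 - ?r x)^n \<le> 1" using small by (intro power_le_one) auto
          then show ?thesis by (simp only: norm_mult norm_power) (intro mult_right_le_one_le, auto)
        qed (use disk_supportedD(2)[OF h, of x] in auto)
      qed
      show "AE x in lborel. (\<lambda>n. h x * ?r x^M * (1 - ?r x)^n) \<longlonglongrightarrow> 0"
        using AE_lborel_singleton[of "0::real^2"]
      proof eventually_elim
        case (elim x)
        show ?case
        proof (cases "norm x < 1")
          case True
          have "(norm x)\<^sup>2 > 0" "(norm x)\<^sup>2 < 1"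
            using elim True by (auto simp: power_less_one_iff abs_square_less_1)
          then have "norm (1 - ?r x) < 1" by (simp only: norm)
          from tendsto_mult_right_zero[OF LIMSEQ_power_zero[OF this]] show ?thesis .
        qed (use disk_supportedD(2)[OF h, of x] in auto)
      qed
    qed simp
    ultimately show ?thesis by (simp add: LIMSEQ_const_iff)
  qed
  obtain M where M: "\<And>j. j \<ge> M \<Longrightarrow> (LINT x|lborel. h x * ?r x^j) = 0"
    using high by (auto simp: eventually_sequentially)
  have "\<forall>j\<ge>M - i. (LINT x|lborel. h x * ?r x^j) = 0" for i
  proof (induction i)
    case (Suc i)
    show ?case
    proof (intro allI impI)
      fix j assume "j \<ge> M - Suc i"
      show "(LINT x|lborel. h x * ?r x^j) = 0"
        by (rule step) (use Suc \<open>j \<ge> M - Suc i\<close> in auto)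
    qed
  qed (use M in auto)
  from this[of M] show ?thesis by simp
qed

section \<open>From beam data to integrals of heat polynomials\<close>

text \<open>The normalising factors \<open>1 / beam_width\<close> of kernel and density agree, so the constant \<open>w0 * sqrt pi\<close> is
  independent of \<open>v\<close>. This is what makes the moments in \<open>s\<close> polynomial in \<open>u\<close> and \<open>v\<close>.\<close>
lemma beam_kernel_eq_normal_density:
  assumes "w0 > 0"
  shows "beam_kernel w0 l (s - u) v = w0 * sqrt pi * normal_density u (beam_width w0 l v / sqrt 2) s"
proof -
  have "beam_width w0 l v > 0"
    using assms by (auto simp: beam_width_def add_pos_nonneg)
  then show ?thesis
    by (simp add: beam_kernel_def normal_density_def power_divide real_sqrt_mult)
qed

lemma has_bochner_integral_beam_kernel_moment:
  assumes "w0 > 0"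
  shows "has_bochner_integral lborel (\<lambda>s. beam_kernel w0 l (s - u) v * s^n)
           (w0 * sqrt pi * heat_poly n u ((beam_width w0 l v)\<^sup>2 / 2))"
proof -
  have "beam_width w0 l v / sqrt 2 > 0"
    using assms by (auto simp: beam_width_def add_pos_nonneg)
  from has_bochner_integral_mult_right[OF has_bochner_integral_normal_density_power[OF this, of u n], of "w0 * sqrt pi"]
  show ?thesis using assms
    by (simp add: beam_kernel_eq_normal_density power_divide mult_ac)
qed

lemma continuous_on_beam_kernel:
  assumes "w0 > 0" "continuous_on A U" "continuous_on A V"
  shows "continuous_on A (\<lambda>x. beam_kernel w0 l (U x) (V x))"
proof -
  have "sqrt (1 + (v / rayleigh_range w0 l)\<^sup>2) \<noteq> 0" for v
    by (metis add_nonneg_eq_0_iff real_sqrt_eq_zero_cancel_iff zero_le_one zero_le_power2 zero_neq_one)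
  then show ?thesis
    unfolding beam_kernel_def beam_width_def divide_inverse[of _ "rayleigh_range w0 l"]
    by (intro continuous_intros assms) (use assms in \<open>auto simp: divide_inverse\<close>)
qed

text \<open>Multiply the data by \<open>s\<^sup>n\<close>, integrate over \<open>s\<close> and exchange the integrals: the inner integral becomes a
  moment of the kernel.\<close>
lemma beam_data_moments:
  fixes g :: "real^2 \<Rightarrow> real"
  assumes w0: "w0 > 0" and g: "disk_supported g"
    and data: "\<And>s. (LINT x|lborel. beam_kernel w0 l (s - d \<bullet> x) (e \<bullet> x) * g x) = 0"
  shows "(LINT x|lborel. g x * heat_poly n (d \<bullet> x) ((beam_width w0 l (e \<bullet> x))\<^sup>2 / 2)) = 0"
proof -
  define F where "F m x s = beam_kernel w0 l (s - d \<bullet> x) (e \<bullet> x) * s^m * g x" for m x s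
  have meas [measurable]: "case_prod (F m) \<in> borel_measurable (lborel \<Otimes>\<^sub>M lborel)" for m
  proof -
    have "continuous_on UNIV (\<lambda>p. F m (fst p) (snd p))"
      unfolding F_def using disk_supportedD(1)[OF g]
      by (intro continuous_intros continuous_on_beam_kernel w0 continuous_on_compose2[OF disk_supportedD(1)[OF g, of UNIV]]) auto
    then show ?thesis
      unfolding lborel_prod by (simp add: case_prod_unfold borel_measurable_continuous_onI)
  qed
  have slice: "has_bochner_integral lborel (F m x)
      (w0 * sqrt pi * heat_poly m (d \<bullet> x) ((beam_width w0 l (e \<bullet> x))\<^sup>2 / 2) * g x)" for m x
    unfolding F_def by (intro has_bochner_integral_mult_left has_bochner_integral_beam_kernel_moment w0)
  have kernel_nonneg: "beam_kernel w0 l a b \<ge> 0" for a b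
    using w0 by (simp add: beam_kernel_def beam_width_def)
  \<comment> \<open>For even \<open>m\<close> the power \<open>s\<^sup>m\<close> is nonnegative, so the absolute integral over \<open>s\<close> is again a heat
     polynomial; the odd powers are then dominated by \<open>1 + s^(2 * n)\<close>.\<close>
  have even: "integrable (lborel \<Otimes>\<^sub>M lborel) (case_prod (F m))" if "even m" for m
  proof (rule lborel_pair.Fubini_integrable[OF meas])
    have "norm (F m x s) = beam_kernel w0 l (s - d \<bullet> x) (e \<bullet> x) * s^m * \<bar>g x\<bar>" for x s
      using that kernel_nonneg by (simp add: F_def abs_mult power_even_abs zero_le_even_power)
    then have "(LINT s|lborel. norm (F m x s)) =
        \<bar>g x\<bar> * (w0 * sqrt pi * heat_poly m (d \<bullet> x) ((beam_width w0 l (e \<bullet> x))\<^sup>2 / 2))" for x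
      using has_bochner_integral_mult_left[OF has_bochner_integral_beam_kernel_moment[OF w0], THEN has_bochner_integral_integral_eq]
      by (simp add: mult_ac)
    moreover have "integrable lborel
        (\<lambda>x. \<bar>g x\<bar> * (w0 * sqrt pi * heat_poly m (d \<bullet> x) ((beam_width w0 l (e \<bullet> x))\<^sup>2 / 2)))"
      using g unfolding beam_width_def divide_inverse
      by (intro integrable_disk_supported disk_supported_mult continuous_intros)
         (auto simp: disk_supported_def intro!: continuous_intros)
    ultimately show "integrable lborel (\<lambda>x. LINT s|lborel. norm (case (x, s) of (x, s) \<Rightarrow> F m x s))"
      by simp
  qed (use slice in \<open>auto simp: has_bochner_integral_iff\<close>)
  have "integrable (lborel \<Otimes>\<^sub>M lborel) (case_prod (F n))"
  proof (rule Bochner_Integration.integrable_bound)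
    show "integrable (lborel \<Otimes>\<^sub>M lborel) (\<lambda>p. \<bar>case_prod (F 0) p\<bar> + \<bar>case_prod (F (2*n)) p\<bar>)"
      using even[of 0] even[of "2*n"] by (intro Bochner_Integration.integrable_add integrable_abs) auto
    have "\<bar>F n x s\<bar> \<le> \<bar>F 0 x s\<bar> + \<bar>F (2*n) x s\<bar>" for x s
    proof -
      have "0 \<le> (\<bar>s^n\<bar> - 1)\<^sup>2 + \<bar>s^n\<bar>" by simp
      then have "\<bar>s^n\<bar> \<le> 1 + \<bar>s^n\<bar>\<^sup>2" by (simp add: power2_eq_square algebra_simps)
      then have "\<bar>s^n\<bar> \<le> 1 + \<bar>s^(2*n)\<bar>" by (simp add: power_mult mult.commute[of 2])
      then have "\<bar>beam_kernel w0 l (s - d \<bullet> x) (e \<bullet> x) * g x\<bar> * \<bar>s^n\<bar>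
          \<le> \<bar>beam_kernel w0 l (s - d \<bullet> x) (e \<bullet> x) * g x\<bar> * (1 + \<bar>s^(2*n)\<bar>)"
        by (intro mult_left_mono) auto
      then show ?thesis by (simp add: F_def abs_mult algebra_simps)
    qed
    then show "AE p in lborel \<Otimes>\<^sub>M lborel. norm (case_prod (F n) p) \<le> norm (\<bar>case_prod (F 0) p\<bar> + \<bar>case_prod (F (2*n)) p\<bar>)"
      by (intro AE_I2) (auto simp: case_prod_unfold)
  qed (rule meas)
  from lborel_pair.Fubini_integral[OF this]
  have "(LINT s|lborel. LINT x|lborel. F n x s) =
      (LINT x|lborel. w0 * sqrt pi * heat_poly n (d \<bullet> x) ((beam_width w0 l (e \<bullet> x))\<^sup>2 / 2) * g x)"
    using slice by (simp add: has_bochner_integral_iff)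
  also have "\<dots> = w0 * sqrt pi * (LINT x|lborel. g x * heat_poly n (d \<bullet> x) ((beam_width w0 l (e \<bullet> x))\<^sup>2 / 2))"
    by (subst integral_mult_right_zero[symmetric]) (simp add: mult_ac)
  also have "(LINT x|lborel. F n x s) = s^n * (LINT x|lborel. beam_kernel w0 l (s - d \<bullet> x) (e \<bullet> x) * g x)" for s
    unfolding F_def by (subst integral_mult_right_zero[symmetric]) (simp add: mult_ac)
  then have "(LINT s|lborel. LINT x|lborel. F n x s) = 0"
    by (simp add: data)
  finally show ?thesis using w0 by simp
qed

text \<open>By \<open>heat_poly_add\<close> the integral for \<open>Q + c\<close> is the one for \<open>Q\<close> plus integrals for \<open>Q\<close> of smaller degree.\<close>
lemma heat_poly_moments_shift:
  fixes g :: "real^2 \<Rightarrow> real"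
  assumes g: "disk_supported g" and cont: "continuous_on UNIV U" "continuous_on UNIV Q"
    and shifted: "\<And>n. (LINT x|lborel. g x * heat_poly n (U x) (Q x + c)) = 0"
  shows "(LINT x|lborel. g x * heat_poly n (U x) (Q x)) = 0"
proof (induction n rule: less_induct)
  case (less n)
  let ?k = "\<lambda>i. fact n / (fact (n - 2*i) * fact i * 2^i) * c^i :: real"
  let ?I = "\<lambda>m. LINT x|lborel. g x * heat_poly m (U x) (Q x)"
  have "0 = (LINT x|lborel. (\<Sum>i\<le>n div 2. ?k i * (g x * heat_poly (n - 2*i) (U x) (Q x))))"
    using shifted[of n] by (simp add: heat_poly_add sum_distrib_left mult_ac)
  also have "\<dots> = (\<Sum>i\<le>n div 2. LINT x|lborel. ?k i * (g x * heat_poly (n - 2*i) (U x) (Q x)))"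
    by (intro Bochner_Integration.integral_sum integrable_mult_right integrable_disk_supported
          disk_supported_mult g continuous_intros cont)
  also have "\<dots> = (\<Sum>i\<le>n div 2. ?k i * ?I (n - 2*i))"
    by (simp only: integral_mult_right_zero)
  also have "\<dots> = (\<Sum>i\<in>{0}. ?k i * ?I (n - 2*i))"
  proof (rule sum.mono_neutral_right)
    show "\<forall>i\<in>{..n div 2} - {0}. ?k i * ?I (n - 2*i) = 0"
    proof
      fix i assume "i \<in> {..n div 2} - {0}"
      then have "n - 2*i < n" by auto
      from less[OF this] show "?k i * ?I (n - 2*i) = 0" by (simp only: mult_zero_right)
    qed
  qed auto
  finally show ?case by simp
qed

section \<open>Expansion in powers of the complex coordinate\<close>

lemma integrable_std_normal_poly:
  fixes p :: "complex poly"
  shows "integrable lborel (\<lambda>t. complex_of_real (std_normal_density t) * poly p (of_real t))"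
proof -
  have "integrable lborel (\<lambda>t. \<Sum>i\<le>degree p. coeff p i * complex_of_real (std_normal_density t * t^i))"
  proof (intro Bochner_Integration.integrable_sum integrable_mult_right integrable_of_real)
    show "integrable lborel (\<lambda>t. std_normal_density t * t^i)" for i
      using integrable_normal_moment[of 1 0 i] by simp
  qed
  then show ?thesis by (simp add: poly_altdef sum_distrib_left mult_ac)
qed

text \<open>Up to the factor \<open>((a + b) choose a) / 2 ^ (a + b)\<close>, the coefficient of \<open>w\<^sup>a cnj w\<^sup>b\<close> in \<open>heat_poly (a + b) (Re w) ((\<beta> * Im w)\<^sup>2)\<close>.\<close>
definition beam_coeff :: "real \<Rightarrow> nat \<Rightarrow> nat \<Rightarrow> complex" where
  "beam_coeff \<beta> a b = (LINT t|lborel. complex_of_real (std_normal_density t) *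
      ((1 - \<i> * of_real (\<beta> * t))^a * (1 + \<i> * of_real (\<beta> * t))^b))"

lemma integrable_beam_coeff:
  "integrable lborel (\<lambda>t. complex_of_real (std_normal_density t) *
      ((1 - \<i> * of_real (\<beta> * t))^a * (1 + \<i> * of_real (\<beta> * t))^b))"
  using integrable_std_normal_poly[of "[:1, - \<i> * of_real \<beta>:]^a * [:1, \<i> * of_real \<beta>:]^b"]
  by (simp add: poly_power mult_ac)

text \<open>For real \<open>t\<close>, \<open>Re w + \<beta> (Im w) t\<close> is the mean of \<open>w (1 - \<i> \<beta> t)\<close> and its conjugate; the formula is the binomial
  theorem under the expectation.\<close>
lemma heat_poly_eq_sum_beam_coeff:
  "complex_of_real (heat_poly n (Re w) ((\<beta> * Im w)\<^sup>2)) =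
     (\<Sum>a\<le>n. of_nat (n choose a) / 2^n * beam_coeff \<beta> a (n-a) * w^a * cnj w^(n-a))"
proof -
  let ?h = "\<lambda>t a. complex_of_real (std_normal_density t) *
      ((1 - \<i> * of_real (\<beta> * t))^a * (1 + \<i> * of_real (\<beta> * t))^(n-a))"
  have "complex_of_real (heat_poly n (Re w) ((\<beta> * Im w)\<^sup>2)) =
          of_real (LINT t|lborel. std_normal_density t * (Re w + \<beta> * Im w * t)^n)"
    using has_bochner_integral_std_normal_affine_power[THEN has_bochner_integral_integral_eq] by simp
  also have "\<dots> = (LINT t|lborel. of_real (std_normal_density t * (Re w + \<beta> * Im w * t)^n))"
    by (rule integral_complex_of_real[symmetric])
  also have "\<dots> = (LINT t|lborel. (\<Sum>a\<le>n. of_nat (n choose a) / 2^n * w^a * cnj w^(n-a) * ?h t a))"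
  proof (rule Bochner_Integration.integral_cong[OF refl])
    fix t
    have "complex_of_real (Re w + \<beta> * Im w * t) =
            (w * (1 - \<i> * of_real (\<beta> * t)) + cnj w * (1 + \<i> * of_real (\<beta> * t))) / 2"
      by (auto simp: complex_eq_iff algebra_simps)
    then have "complex_of_real ((Re w + \<beta> * Im w * t)^n) =
            ((w * (1 - \<i> * of_real (\<beta> * t)) + cnj w * (1 + \<i> * of_real (\<beta> * t))) / 2)^n"
      by (simp only: of_real_power)
    moreover have "d * ((w * A + cnj w * B) / 2)^n =
        (\<Sum>a\<le>n. of_nat (n choose a) / 2^n * w^a * cnj w^(n-a) * (d * (A^a * B^(n-a))))" for A B d :: complex
      unfolding power_divide binomial_ring
      by (simp add: sum_divide_distrib sum_distrib_left power_mult_distrib mult_ac)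
    ultimately show "complex_of_real (std_normal_density t * (Re w + \<beta> * Im w * t)^n) =
          (\<Sum>a\<le>n. of_nat (n choose a) / 2^n * w^a * cnj w^(n-a) * ?h t a)"
      by (simp only: of_real_mult)
  qed
  also have "\<dots> = (\<Sum>a\<le>n. LINT t|lborel. of_nat (n choose a) / 2^n * w^a * cnj w^(n-a) * ?h t a)"
    by (intro Bochner_Integration.integral_sum integrable_mult_right integrable_beam_coeff)
  also have "\<dots> = (\<Sum>a\<le>n. of_nat (n choose a) / 2^n * w^a * cnj w^(n-a) * beam_coeff \<beta> a (n-a))"
    unfolding beam_coeff_def by (simp only: integral_mult_right_zero)
  finally show ?thesis by (simp add: mult_ac)
qed

lemma dir_components:
  "dir \<theta> \<bullet> x = Re (cnj (cis \<theta>) * to_complex x)"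
  "dir_perp \<theta> \<bullet> x = Im (cnj (cis \<theta>) * to_complex x)"
  by (simp_all add: dir_def dir_perp_def to_complex_def inner_vec_def sum_2)

text \<open>Rotation by \<open>- \<theta>\<close> multiplies \<open>z ^ i * cnj z ^ (n - i)\<close> by \<open>cis \<theta> ^ n * cis (- 2 \<theta>) ^ i\<close>. So the hypothesis says that a
  polynomial of degree at most \<open>n\<close> vanishes at infinitely many points \<open>cis (- 2 \<theta>)\<close>, which separates the
  exponents \<open>i\<close>.\<close>
lemma moments_times_beam_coeff:
  fixes g :: "real^2 \<Rightarrow> real"
  assumes g: "disk_supported g"
    and zero: "\<And>n \<theta>. 0 \<le> \<theta> \<Longrightarrow> \<theta> < 2 * pi \<Longrightarrow>
      (LINT x|lborel. g x * heat_poly n (dir \<theta> \<bullet> x) ((\<beta> * (dir_perp \<theta> \<bullet> x))\<^sup>2)) = 0"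
  shows "beam_coeff \<beta> a b * (LINT x|lborel. complex_of_real (g x) * (to_complex x^a * cnj (to_complex x)^b)) = 0"
proof -
  define n where "n = a + b"
  define M where "M i = (LINT x|lborel. complex_of_real (g x) * (to_complex x^i * cnj (to_complex x)^(n-i)))" for i
  define c where "c i = of_nat (n choose i) / 2^n * beam_coeff \<beta> i (n-i) * M i" for i
  have roots: "(\<Sum>i\<le>n. c i * cis (- (2 * \<theta>))^i) = 0" if "0 \<le> \<theta>" "\<theta> < 2 * pi" for \<theta>
  proof -
    let ?e = "\<lambda>i. of_nat (n choose i) / 2^n * beam_coeff \<beta> i (n-i)"
    let ?m = "\<lambda>i x. complex_of_real (g x) * (to_complex x^i * cnj (to_complex x)^(n-i))"
    have "complex_of_real (g x * heat_poly n (dir \<theta> \<bullet> x) ((\<beta> * (dir_perp \<theta> \<bullet> x))\<^sup>2)) =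
        (\<Sum>i\<le>n. cis \<theta>^n * ?e i * cis (- (2 * \<theta>))^i * ?m i x)" for x
    proof -
      have "(cnj (cis \<theta>) * to_complex x)^i * cnj (cnj (cis \<theta>) * to_complex x)^(n-i)
          = cis \<theta>^n * cis (- (2 * \<theta>))^i * (to_complex x^i * cnj (to_complex x)^(n-i))" if "i \<le> n" for i
      proof -
        have "cnj (cis \<theta>)^i * cis \<theta>^(n-i) = cis \<theta>^n * cis (- (2 * \<theta>))^i"
          unfolding cis_cnj Complex.DeMoivre cis_mult
          using that by (intro arg_cong[where f = cis]) (simp add: of_nat_diff algebra_simps)
        then show ?thesis by (simp add: power_mult_distrib mult_ac)
      qed
      then show ?thesis
        unfolding of_real_mult dir_components heat_poly_eq_sum_beam_coeff sum_distrib_left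
        by (intro sum.cong refl) (simp add: mult_ac)
    qed
    then have "complex_of_real (LINT x|lborel. g x * heat_poly n (dir \<theta> \<bullet> x) ((\<beta> * (dir_perp \<theta> \<bullet> x))\<^sup>2)) =
        (LINT x|lborel. (\<Sum>i\<le>n. cis \<theta>^n * ?e i * cis (- (2 * \<theta>))^i * ?m i x))"
      by (simp only: flip: integral_complex_of_real)
    also have "\<dots> = (\<Sum>i\<le>n. LINT x|lborel. cis \<theta>^n * ?e i * cis (- (2 * \<theta>))^i * ?m i x)"
      by (intro Bochner_Integration.integral_sum integrable_mult_right integrable_disk_supported
            disk_supported_mult_to_complex disk_supported_of_real g)
    also have "\<dots> = cis \<theta>^n * (\<Sum>i\<le>n. c i * cis (- (2 * \<theta>))^i)"
      unfolding integral_mult_right_zero c_def M_def sum_distrib_left by (simp add: mult_ac)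
    finally show ?thesis using zero[OF that] by simp
  qed
  \<comment> \<open>On \<open>[0, pi / 2]\<close> already the real part \<open>cos (2 \<theta>)\<close> tells the angles apart.\<close>
  have "infinite ((\<lambda>\<theta>. cis (- (2 * \<theta>))) ` {0..pi/2})"
  proof
    assume "finite ((\<lambda>\<theta>. cis (- (2 * \<theta>))) ` {0..pi/2})"
    moreover have "inj_on (\<lambda>\<theta>. cis (- (2 * \<theta>))) {0..pi/2}"
    proof (rule inj_onI)
      fix s t assume s: "s \<in> {0..pi/2}" and t: "t \<in> {0..pi/2}"
        and "cis (- (2 * s)) = cis (- (2 * t))"
      then have "Re (cis (- (2 * s))) = Re (cis (- (2 * t)))" by (simp only:)
      then have "cos (2 * s) = cos (2 * t)" by (simp only: cis.sel cos_minus)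
      then have "2 * s = 2 * t"
        using s t by (intro cos_inj_pi[of "2 * s" "2 * t"]) simp_all
      then show "s = t" by simp
    qed
    ultimately have "finite {0..pi/2}" by (rule finite_imageD)
    then show False by (simp add: infinite_Icc)
  qed
  moreover have "(\<lambda>\<theta>. cis (- (2 * \<theta>))) ` {0..pi/2} \<subseteq> {z. (\<Sum>i\<le>n. c i * z^i) = 0}"
  proof (intro image_subsetI CollectI roots)
    fix \<theta> assume "\<theta> \<in> {0..pi/2}"
    then show "0 \<le> \<theta>" "\<theta> < 2 * pi" using pi_gt_zero by (simp, simp only: atLeastAtMost_iff, linarith)
  qed
  ultimately have "infinite {z. (\<Sum>i\<le>n. c i * z^i) = 0}"
    using finite_subset by blast
  then have "c a = 0"
    using polyfun_finite_roots[of c n] by (auto simp: n_def)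
  then show ?thesis by (simp add: c_def M_def n_def)
qed

section \<open>Nonvanishing of the coefficients far along a diagonal\<close>

text \<open>The contribution of \<open>\<bar>t\<bar> \<le> R\<close>, where \<open>q\<close> may be negative, grows at most like \<open>(1 + (\<beta> R)\<^sup>2)\<^sup>m\<close>, while
  \<open>[R + 1, R + 2]\<close> alone contributes at least a multiple of the larger \<open>(1 + (\<beta> (R + 1))\<^sup>2)\<^sup>m\<close>.\<close>
lemma eventually_normal_moment_pos:
  fixes q :: "real \<Rightarrow> real"
  assumes cont: "continuous_on UNIV q"
    and int: "\<And>m. integrable lborel (\<lambda>t. std_normal_density t * (1 + (\<beta>*t)\<^sup>2)^m * q t)"
    and "\<beta> > 0" "\<epsilon> > 0" "R \<ge> 0" and large: "\<And>t. \<bar>t\<bar> \<ge> R \<Longrightarrow> q t \<ge> \<epsilon>"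
  shows "\<forall>\<^sub>F m in sequentially. (LINT t|lborel. std_normal_density t * (1 + (\<beta>*t)\<^sup>2)^m * q t) > 0"
proof -
  define l where "l = 1 + (\<beta>*R)\<^sup>2"
  define L where "L = 1 + (\<beta>*(R+1))\<^sup>2"
  have l: "l > 0" "l < L"
    using assms by (auto simp: l_def L_def add_pos_nonneg intro!: power_strict_mono)
  obtain M where M: "\<And>t. t \<in> {-R..R} \<Longrightarrow> \<bar>std_normal_density t * q t\<bar> \<le> M" and "M > 0"
  proof -
    have "continuous_on {-R..R} std_normal_density"
      unfolding normal_density_def by (intro continuous_intros) auto
    then have "compact ((\<lambda>t. std_normal_density t * q t) ` {-R..R})"
      using continuous_on_subset[OF cont subset_UNIV]
      by (intro compact_continuous_image continuous_on_mult compact_Icc)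
    from compact_imp_bounded[OF this] obtain M
      where "M > 0" "\<forall>y\<in>(\<lambda>t. std_normal_density t * q t) ` {-R..R}. norm y \<le> M"
      unfolding bounded_pos by metis
    then show ?thesis by (intro that[of M]) auto
  qed
  define \<delta> where "\<delta> = std_normal_density (R+2) * \<epsilon>"
  have "\<delta> > 0" using \<open>\<epsilon> > 0\<close> by (simp add: \<delta>_def normal_density_pos)
  have pointwise: "\<delta> * L^m * indicator {R+1..R+2} t - M * l^m * indicator {-R..R} t
      \<le> std_normal_density t * (1 + (\<beta>*t)\<^sup>2)^m * q t" for m t
  proof (cases "\<bar>t\<bar> \<le> R")
    case True
    have "t\<^sup>2 \<le> R\<^sup>2" using True abs_le_square_iff[of t R] \<open>R \<ge> 0\<close> by simp
    then have "1 + (\<beta>*t)\<^sup>2 \<le> l" by (simp add: l_def power_mult_distrib mult_left_mono)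
    then have "(1 + (\<beta>*t)\<^sup>2)^m \<le> l^m" by (intro power_mono) (auto intro: add_nonneg_nonneg)
    moreover have "\<bar>std_normal_density t * q t\<bar> \<le> M" using True by (intro M) auto
    ultimately have "\<bar>std_normal_density t * q t\<bar> * (1 + (\<beta>*t)\<^sup>2)^m \<le> M * l^m"
      using \<open>M > 0\<close> by (intro mult_mono) auto
    moreover have "\<bar>std_normal_density t * q t\<bar> * (1 + (\<beta>*t)\<^sup>2)^m =
        \<bar>std_normal_density t * (1 + (\<beta>*t)\<^sup>2)^m * q t\<bar>"
      by (simp add: abs_mult add_nonneg_nonneg)
    ultimately show ?thesis using True by (auto simp: indicator_def)
  next
    case False
    then have q: "q t \<ge> \<epsilon>" by (intro large) auto
    show ?thesis
    proof (cases "t \<in> {R+1..R+2}")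
      case True
      have "t\<^sup>2 \<ge> (R+1)\<^sup>2" "t\<^sup>2 \<le> (R+2)\<^sup>2" using True \<open>R \<ge> 0\<close> by (auto intro!: power_mono)
      then have "std_normal_density (R+2) \<le> std_normal_density t" "L \<le> 1 + (\<beta>*t)\<^sup>2"
        by (auto simp: normal_density_def L_def power_mult_distrib mult_left_mono divide_right_mono)
      then have "std_normal_density (R+2) * L^m * \<epsilon> \<le> std_normal_density t * (1 + (\<beta>*t)\<^sup>2)^m * q t"
        using q \<open>\<epsilon> > 0\<close> l by (intro mult_mono power_mono) auto
      then show ?thesis using True False by (simp add: \<delta>_def mult_ac)
    next
      case notin: False
      have "0 \<le> std_normal_density t * (1 + (\<beta>*t)\<^sup>2)^m * q t"
        using q \<open>\<epsilon> > 0\<close> by (intro mult_nonneg_nonneg) auto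
      then show ?thesis using False notin by (auto simp: indicator_def)
    qed
  qed
  have bound: "\<delta> * L^m - 2 * R * M * l^m \<le> (LINT t|lborel. std_normal_density t * (1 + (\<beta>*t)\<^sup>2)^m * q t)" for m
  proof -
    have "(LINT t|lborel. \<delta> * L^m * indicator {R+1..R+2} t - M * l^m * indicator {-R..R} t)
        \<le> (LINT t|lborel. std_normal_density t * (1 + (\<beta>*t)\<^sup>2)^m * q t)"
      using \<open>R \<ge> 0\<close>
      by (intro integral_mono pointwise int Bochner_Integration.integrable_diff integrable_mult_right)
         (auto simp: integrable_indicator_iff)
    then show ?thesis using \<open>R \<ge> 0\<close> by (simp add: mult_ac)
  qed
  have "\<forall>\<^sub>F m in sequentially. \<delta> * L^m - 2 * R * M * l^m > 0"
  proof -
    have "(\<lambda>m. 2 * R * M * (l/L)^m) \<longlonglongrightarrow> 2 * R * M * 0"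
      using l by (intro tendsto_mult tendsto_const LIMSEQ_power_zero) auto
    then have "\<forall>\<^sub>F m in sequentially. 2 * R * M * (l/L)^m < \<delta>"
      using \<open>\<delta> > 0\<close> by (auto dest: order_tendstoD)
    then show ?thesis
      by eventually_elim (use l in \<open>auto simp: power_divide field_simps\<close>)
  qed
  then show ?thesis
  proof eventually_elim
    case (elim m)
    then show ?case using bound[of m] by linarith
  qed
qed

lemma affine_power_Re_Im_poly:
  "\<exists>p r. \<forall>t. (1 - \<i> * complex_of_real (\<beta> * t))^k = Complex (poly p t) (poly r t)"
proof (induction k)
  case 0
  show ?case by (intro exI[of _ 1] exI[of _ 0]) (simp add: complex_eq_iff)
next
  case (Suc k)
  then obtain p r where "\<And>t. (1 - \<i> * complex_of_real (\<beta> * t))^k = Complex (poly p t) (poly r t)"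
    by blast
  then show ?case
    by (intro exI[of _ "p + [:0, \<beta>:] * r"] exI[of _ "r - [:0, \<beta>:] * p"])
       (auto simp: complex_eq_iff algebra_simps)
qed

text \<open>The real part of \<open>beam_coeff \<beta> (m + k) m\<close> is \<open>E (1 + (\<beta> X)\<^sup>2)\<^sup>m p(X)\<close> with \<open>p(t) = Re (1 - \<i> \<beta> t)\<^sup>k\<close>. This is a polynomial
  with \<open>p(0) = 1\<close>, so it is nonzero; being even, it has the same sign near both ends of the real line.\<close>
lemma eventually_beam_coeff_nonzero:
  assumes "\<beta> > 0"
  shows "\<forall>\<^sub>F m in sequentially. beam_coeff \<beta> (m + k) m \<noteq> 0"
proof -
  let ?A = "\<lambda>t. (1 - \<i> * complex_of_real (\<beta> * t))^k"
  obtain p r where pr: "\<And>t. ?A t = Complex (poly p t) (poly r t)"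
    using affine_power_Re_Im_poly by metis
  then have p: "Re (?A t) = poly p t" for t by simp
  have even: "poly p (- t) = poly p t" for t
  proof -
    have "?A (- t) = cnj (?A t)" by simp
    then have "Re (?A (- t)) = Re (?A t)" by (simp only: cnj.sel)
    then show ?thesis by (simp only: p)
  qed
  have "p \<noteq> 0" using p[of 0] by auto
  define s where "s = sgn (lead_coeff p)"
  have "lead_coeff p \<noteq> 0" using \<open>p \<noteq> 0\<close> by (rule leading_coeff_neq_0)
  then have lead: "lead_coeff (smult s p) > 0"
    unfolding s_def lead_coeff_smult by (metis abs_sgn mult.commute zero_less_abs_iff)
  obtain n where n: "\<And>t. t \<ge> n \<Longrightarrow> poly (smult s p) t \<ge> lead_coeff (smult s p)"
    using poly_pinfty_gt_lc[OF lead] by blast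
  have Re: "Re (beam_coeff \<beta> (m + k) m) = (LINT t|lborel. std_normal_density t * (1 + (\<beta>*t)\<^sup>2)^m * poly p t)"
    and int: "integrable lborel (\<lambda>t. std_normal_density t * (1 + (\<beta>*t)\<^sup>2)^m * poly p t)" for m
  proof -
    have "Re (complex_of_real (std_normal_density t) *
      ((1 - \<i> * of_real (\<beta> * t))^(m+k) * (1 + \<i> * of_real (\<beta> * t))^m))
      = std_normal_density t * (1 + (\<beta>*t)\<^sup>2)^m * poly p t" for t
    proof -
      have "(1 - \<i> * complex_of_real (\<beta> * t)) * (1 + \<i> * of_real (\<beta> * t)) = of_real (1 + (\<beta>*t)\<^sup>2)"
        by (simp add: complex_eq_iff power2_eq_square)
      moreover have "x^(m+k) * y^m = (x * y)^m * x^k" for x y :: complex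
        by (simp add: power_add power_mult_distrib mult_ac)
      ultimately have "(1 - \<i> * complex_of_real (\<beta> * t))^(m+k) * (1 + \<i> * of_real (\<beta> * t))^m
          = of_real ((1 + (\<beta>*t)\<^sup>2)^m) * ?A t"
        by (simp only: of_real_power)
      then have "complex_of_real (std_normal_density t) *
          ((1 - \<i> * of_real (\<beta> * t))^(m+k) * (1 + \<i> * of_real (\<beta> * t))^m)
          = of_real (std_normal_density t * (1 + (\<beta>*t)\<^sup>2)^m) * ?A t"
        by (simp only: of_real_mult mult.assoc)
      moreover have "Re (of_real r * z) = r * Re z" for r z by simp
      ultimately show ?thesis by (simp only: p)
    qed
    note eq = this
    show "Re (beam_coeff \<beta> (m + k) m) = (LINT t|lborel. std_normal_density t * (1 + (\<beta>*t)\<^sup>2)^m * poly p t)"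
      unfolding beam_coeff_def
      by (subst integral_Re[symmetric, OF integrable_beam_coeff]) (simp only: eq)
    show "integrable lborel (\<lambda>t. std_normal_density t * (1 + (\<beta>*t)\<^sup>2)^m * poly p t)"
      using integrable_Re[OF integrable_beam_coeff[of \<beta> "m+k" m]] by (simp only: eq)
  qed
  have "\<forall>\<^sub>F m in sequentially. (LINT t|lborel. std_normal_density t * (1 + (\<beta>*t)\<^sup>2)^m * (s * poly p t)) > 0"
  proof (rule eventually_normal_moment_pos[where R = "\<bar>n\<bar>"])
    show "integrable lborel (\<lambda>t. std_normal_density t * (1 + (\<beta>*t)\<^sup>2)^m * (s * poly p t))" for m
      using integrable_mult_right[OF int[of m], of s] by (simp add: mult_ac)
    show "lead_coeff (smult s p) \<le> s * poly p t" if "\<bar>n\<bar> \<le> \<bar>t\<bar>" for t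
      using n[of "\<bar>t\<bar>"] that even[of t] by (cases "t \<ge> 0") auto
  qed (use assms lead in \<open>auto intro!: continuous_intros\<close>)
  then show ?thesis
  proof eventually_elim
    case (elim m)
    have "(LINT t|lborel. std_normal_density t * (1 + (\<beta>*t)\<^sup>2)^m * (s * poly p t)) = s * Re (beam_coeff \<beta> (m + k) m)"
      unfolding Re by (subst integral_mult_right_zero[symmetric]) (simp add: mult_ac)
    then show ?case using elim by auto
  qed
qed

section \<open>Injectivity of the beam transforms\<close>

text \<open>The moments with \<open>a \<ge> b\<close> are handled diagonal by diagonal; those with \<open>a < b\<close> are their conjugates, since
  \<open>g\<close> is real.\<close>
lemma scalar_beam_transform_injective:
  fixes g :: "real^2 \<Rightarrow> real"
  assumes "w0 > 0" "l > 0" and g: "disk_supported g"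
    and data: "\<And>s \<theta>. 0 \<le> \<theta> \<Longrightarrow> \<theta> < 2 * pi \<Longrightarrow>
      (LINT x|lborel. beam_kernel w0 l (s - dir \<theta> \<bullet> x) (dir_perp \<theta> \<bullet> x) * g x) = 0"
  shows "g x = 0"
proof -
  define \<beta> where "\<beta> = w0 / (sqrt 2 * rayleigh_range w0 l)"
  have "\<beta> > 0" using assms by (simp add: \<beta>_def rayleigh_range_def)
  have width: "(beam_width w0 l v)\<^sup>2 / 2 = (\<beta> * v)\<^sup>2 + w0\<^sup>2 / 2" for v
    by (simp add: beam_width_def \<beta>_def power_mult_distrib power_divide real_sqrt_pow2 add_nonneg_nonneg field_simps)
  let ?M = "\<lambda>a b. LINT x|lborel. complex_of_real (g x) * (to_complex x^a * cnj (to_complex x)^b)"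
  have prod: "beam_coeff \<beta> a b * ?M a b = 0" for a b
  proof (rule moments_times_beam_coeff[OF g])
    fix n \<theta> assume \<theta>: "0 \<le> \<theta>" "\<theta> < 2 * pi"
    show "(LINT x|lborel. g x * heat_poly n (dir \<theta> \<bullet> x) ((\<beta> * (dir_perp \<theta> \<bullet> x))\<^sup>2)) = 0"
      by (rule heat_poly_moments_shift[where c = "w0\<^sup>2 / 2"])
         (use g beam_data_moments[OF \<open>w0 > 0\<close> g data[OF \<theta>]] in \<open>auto simp: width intro!: continuous_intros\<close>)
  qed
  have diag: "?M (m + k) m = 0" for m k
  proof -
    have split: "complex_of_real (g x) * (to_complex x^(m+k) * cnj (to_complex x)^m) =
        of_real (g x) * to_complex x^k * of_real ((norm x)\<^sup>2)^m" for x m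
    proof -
      have "of_real ((norm x)\<^sup>2) = to_complex x * cnj (to_complex x)"
        using complex_norm_square[of "to_complex x"] by simp
      then show ?thesis by (simp add: power_add power_mult_distrib mult_ac)
    qed
    have "(LINT x|lborel. of_real (g x) * to_complex x^k * of_real ((norm x)\<^sup>2)^m) = 0"
    proof (rule radial_moments_descend)
      show "disk_supported (\<lambda>x. complex_of_real (g x) * to_complex x^k)"
        by (intro disk_supported_mult disk_supported_of_real g continuous_intros)
      show "\<forall>\<^sub>F m in sequentially. (LINT x|lborel. of_real (g x) * to_complex x^k * of_real ((norm x)\<^sup>2)^m) = 0"
        using eventually_beam_coeff_nonzero[OF \<open>\<beta> > 0\<close>, of k]
      proof eventually_elim
        case (elim m)
        then have "?M (m + k) m = 0" using prod[of "m+k" m] by simp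
        then show ?case by (simp only: split)
      qed
    qed
    then show ?thesis by (simp only: split)
  qed
  have "?M a b = 0" for a b
  proof (cases "b \<le> a")
    case True
    then show ?thesis using diag[of b "a - b"] by simp
  next
    case False
    have "integrable lborel (\<lambda>x. complex_of_real (g x) * (to_complex x^b * cnj (to_complex x)^a))"
      by (intro integrable_disk_supported disk_supported_mult_to_complex disk_supported_of_real g)
    from integral_bounded_linear[OF bounded_linear_cnj this] have "?M a b = cnj (?M b a)"
      by (simp add: mult_ac)
    then show ?thesis using False diag[of a "b - a"] by simp
  qed
  then show ?thesis by (rule disk_supported_determined_by_moments[OF g])
qed

lemma Cc_inf_disk_supported:
  assumes "g \<in> Cc_inf unit_disk"
  shows "disk_supported g"
proof -
  define S where "S = closure {x. g x \<noteq> 0}"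
  have S: "S \<subseteq> ball 0 1" and smooth: "smooth_on (ball 0 1) g"
    using assms by (simp_all add: Cc_inf_def unit_disk_def S_def)
  have ball: "continuous_on (ball 0 1) g"
    using smooth C_on.simps(1) unfolding smooth_on_def by blast
  have outside: "g x = 0" if "x \<notin> S" for x
    using that closure_subset[of "{x. g x \<noteq> 0}"] unfolding S_def by blast
  have "continuous_on (- S) g"
    by (rule continuous_on_eq[OF continuous_on_const[of _ "0::real"]]) (metis Compl_iff outside)
  then have "continuous_on (ball 0 1 \<union> - S) g"
    using ball by (intro continuous_on_open_Un) (auto simp: S_def)
  also have "ball 0 1 \<union> - S = UNIV" using S by auto
  finally have "continuous_on UNIV g" .
  moreover have "g x = 0" if "norm x \<ge> 1" for x
    using S that by (intro outside) auto
  ultimately show ?thesis by (simp add: disk_supported_def)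
qed

theorem theorem1:
  fixes w0 l :: real and f h :: "real^2 \<Rightarrow> real^2"
  assumes "w0 > 0" and "l > 0"
    and "f \<in> Cc_inf_fields unit_disk" and "h \<in> Cc_inf_fields unit_disk"
    and "\<And>s \<theta>. 0 \<le> \<theta> \<Longrightarrow> \<theta> < 2 * pi \<Longrightarrow>
           longitudinal_transform w0 l f s \<theta> = longitudinal_transform w0 l h s \<theta>"
    and "\<And>s \<theta>. 0 \<le> \<theta> \<Longrightarrow> \<theta> < 2 * pi \<Longrightarrow>
           transverse_transform w0 l f s \<theta> = transverse_transform w0 l h s \<theta>"
  shows "f = h"
proof -
  have supp: "disk_supported (\<lambda>x. f x $ i)" "disk_supported (\<lambda>x. h x $ i)" for i
    using assms(3,4) by (auto simp: Cc_inf_fields_def intro: Cc_inf_disk_supported)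
  have int: "integrable lborel (\<lambda>x. beam_kernel w0 l (s - dir \<theta> \<bullet> x) (dir_perp \<theta> \<bullet> x) * F x)"
    if "disk_supported F" for F :: "real^2 \<Rightarrow> real" and s \<theta>
    unfolding mult.commute[of "beam_kernel _ _ _ _"]
    by (intro integrable_disk_supported disk_supported_mult that continuous_on_beam_kernel assms continuous_intros)
  have linear_comb: "(LINT x|lborel. beam_kernel w0 l (s - dir \<theta> \<bullet> x) (dir_perp \<theta> \<bullet> x) * (v \<bullet> F x)) =
      v $ 1 * (LINT x|lborel. beam_kernel w0 l (s - dir \<theta> \<bullet> x) (dir_perp \<theta> \<bullet> x) * F x $ 1) +
      v $ 2 * (LINT x|lborel. beam_kernel w0 l (s - dir \<theta> \<bullet> x) (dir_perp \<theta> \<bullet> x) * F x $ 2)"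
    if "\<And>i. disk_supported (\<lambda>x. F x $ i)" for F :: "real^2 \<Rightarrow> real^2" and v s \<theta>
  proof -
    have "beam_kernel w0 l (s - dir \<theta> \<bullet> x) (dir_perp \<theta> \<bullet> x) * (v \<bullet> F x) =
        v $ 1 * (beam_kernel w0 l (s - dir \<theta> \<bullet> x) (dir_perp \<theta> \<bullet> x) * F x $ 1) +
        v $ 2 * (beam_kernel w0 l (s - dir \<theta> \<bullet> x) (dir_perp \<theta> \<bullet> x) * F x $ 2)" for x
      by (simp add: inner_vec_def sum_2 algebra_simps)
    then show ?thesis using int[OF that] by simp
  qed
  have "f x $ i - h x $ i = 0" for x i
  proof (rule scalar_beam_transform_injective[OF assms(1,2), where g = "\<lambda>x. f x $ i - h x $ i"])
    show "disk_supported (\<lambda>x. f x $ i - h x $ i)"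
      using supp[of i] unfolding disk_supported_def by (simp add: continuous_on_diff)
    fix s \<theta> :: real assume \<theta>: "0 \<le> \<theta>" "\<theta> < 2 * pi"
    define J where "J F j = (LINT x|lborel. beam_kernel w0 l (s - dir \<theta> \<bullet> x) (dir_perp \<theta> \<bullet> x) * F x $ j)"
      for F :: "real^2 \<Rightarrow> real^2" and j
    define p where "p = J f 1 - J h 1"
    define q where "q = J f 2 - J h 2"
    have L: "- sin \<theta> * p + cos \<theta> * q = 0"
      using assms(5)[OF \<theta>, of s] unfolding longitudinal_transform_def linear_comb[OF supp(1)] linear_comb[OF supp(2)]
      by (simp add: dir_perp_def p_def q_def J_def algebra_simps)
    have T: "cos \<theta> * p + sin \<theta> * q = 0"
      using assms(6)[OF \<theta>, of s] unfolding transverse_transform_def linear_comb[OF supp(1)] linear_comb[OF supp(2)]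
      by (simp add: dir_def p_def q_def J_def algebra_simps)
    \<comment> \<open>The data give the components of \<open>(p, q)\<close> in the orthonormal basis \<open>dir \<theta>\<close>, \<open>dir_perp \<theta>\<close>.\<close>
    have "p = cos \<theta> * (cos \<theta> * p + sin \<theta> * q) - sin \<theta> * (- sin \<theta> * p + cos \<theta> * q)"
      using sin_cos_squared_add[of \<theta>] by algebra
    then have "p = 0" unfolding L T by simp
    have "q = sin \<theta> * (cos \<theta> * p + sin \<theta> * q) + cos \<theta> * (- sin \<theta> * p + cos \<theta> * q)"
      using sin_cos_squared_add[of \<theta>] by algebra
    then have "q = 0" unfolding L T by simp
    have "J f i = J h i"
      using exhaust_2[of i] \<open>p = 0\<close> \<open>q = 0\<close> by (auto simp: p_def q_def)
    then show "(LINT x|lborel. beam_kernel w0 l (s - dir \<theta> \<bullet> x) (dir_perp \<theta> \<bullet> x) * (f x $ i - h x $ i)) = 0"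
      using int[OF supp(1)] int[OF supp(2)] by (simp add: J_def right_diff_distrib)
  qed
  then show ?thesis by (simp add: fun_eq_iff vec_eq_iff)
qed

end
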